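(* There exists a universal constant $c>0$ such that the following holds. For integers $1\le k\le d$, denote the class of $k$-sparse linear predictors by $$\mathcal{H}^{d,k}_{\mathrm{lin}}=\{\langle w,\cdot\rangle:w\in\mathbb{R}^d,\ \|w\|_0\le k\},$$ where $\|w\|_0$ is the number of non-zero coordinates of $w$. Let $S_n^{\Phi}=(\Phi_i)_{i=1}^n$, where $\Phi_i\in\mathbb{R}^d$ are arbitrary. Then, for any $\gamma>0$, $$\mathfrak{R}^{\mathrm{off}}(S_n^{\Phi},\mathcal{H}^{d,k}_{\mathrm{lin}},\gamma)\le\frac{c}{\gamma}\log\Big(\frac{ed}{k}\Big)\frac kn.$$
   Context: For a sample $S_n^X=(X_i)_{i=1}^n$ of points in a set $\mathcal{X}$, a class $\mathcal{H}$ of functions $\mathcal{X}\to\mathbb{R}$ and $\gamma>0$, the empirical offset Rademacher complexity is $$\mathfrak{R}^{\mathrm{off}}(S_n^X,\mathcal{H},\gamma)=\mathbf{E}_\sigma\Big[\sup_{h\in\mathcal{H}}\Big\{\frac1n\sum_{i=1}^n\big(\sigma_ih(X_i)-\gamma h(X_i)^2\big)\Big\}\,\Big|\,S_n^X\Big],$$ where $\sigma=(\sigma_1,\dots,\sigma_n)$ are i.i.d. Rademacher (symmetric $\{\pm1\}$-valued) random variables. Here it is applied with $\mathcal{X}=\mathbb{R}^d$ and $X_i=\Phi_i$. *)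

theory Defs
  imports "HOL-Probability.Probability" "Jordan_Normal_Form.Matrix"
begin

definition rademacher_signs :: "nat \<Rightarrow> (nat \<Rightarrow> real) pmf" where
  "rademacher_signs n = Pi_pmf {1..n} 0 (\<lambda>_. pmf_of_set {-1, 1})"

text \<open>
  The sample is the family \<open>X 1, \<dots>, X n\<close>; values of \<open>X\<close> at other indices are irrelevant.
  The supremum is taken in the reals. It is a genuine supremum whenever \<open>\<gamma> > 0\<close>
  and \<open>H\<close> is nonempty, by \<open>bdd_above_offset\<close> below.
\<close>

definition offset_rademacher ::
  "nat \<Rightarrow> (nat \<Rightarrow> 'a) \<Rightarrow> ('a \<Rightarrow> real) set \<Rightarrow> real \<Rightarrow> real" where
  "offset_rademacher n X H \<gamma> =
     measure_pmf.expectation (rademacher_signs n)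
       (\<lambda>\<sigma>. SUP h\<in>H. 1 / real n * (\<Sum>i=1..n. (\<sigma> i * h (X i) - \<gamma> * (h (X i))\<^sup>2)))"

lemma bdd_above_offset:
  fixes \<sigma> :: "nat \<Rightarrow> real"
  assumes "\<gamma> > 0"
  shows "bdd_above ((\<lambda>h. 1 / real n * (\<Sum>i=1..n. (\<sigma> i * h (X i) - \<gamma> * (h (X i))\<^sup>2))) ` H)"
proof (rule bdd_aboveI2)
  fix h
  have "s * t - \<gamma> * t\<^sup>2 \<le> s\<^sup>2 / (4 * \<gamma>)" for s t :: real
  proof -
    have "0 \<le> (s - 2 * \<gamma> * t)\<^sup>2 / (4 * \<gamma>)"
      using assms by simp
    also have "\<dots> = s\<^sup>2 / (4 * \<gamma>) - (s * t - \<gamma> * t\<^sup>2)"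
      using assms by (simp add: field_simps power2_eq_square)
    finally show ?thesis by simp
  qed
  then show "1 / real n * (\<Sum>i=1..n. (\<sigma> i * h (X i) - \<gamma> * (h (X i))\<^sup>2))
      \<le> 1 / real n * (\<Sum>i=1..n. (\<sigma> i)\<^sup>2 / (4 * \<gamma>))"
    by (intro mult_left_mono sum_mono) auto
qed

definition l0_norm :: "real Matrix.vec \<Rightarrow> nat" where
  "l0_norm w = card {j. j < dim_vec w \<and> vec_index w j \<noteq> 0}"

text \<open>
  \<open>\<real>\<^sup>d\<close> is \<open>carrier_vec d\<close> rather than a type-indexed space, since a constant that does not
  depend on the dimension requires quantifying over \<open>d\<close> inside a formula.
\<close>

definition sparse_linear_predictors :: "nat \<Rightarrow> nat \<Rightarrow> (real Matrix.vec \<Rightarrow> real) set" where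
  "sparse_linear_predictors d k =
     {\<lambda>x. scalar_prod w x | w. w \<in> carrier_vec d \<and> l0_norm w \<le> k}"

end

theory Submission
  imports Defs
begin

text \<open>
  The predictions of the vectors supported in a fixed set \<open>S\<close> of \<open>k\<close> coordinates form a subspace
  of dimension at most \<open>k\<close>; if \<open>P\<^sub>S\<close> is the orthogonal projection onto it, completing the square
  bounds the offset process over this subspace by \<open>\<bar>P\<^sub>S \<sigma>\<bar>\<^sup>2 / (4 \<gamma> n)\<close>. A comparison with Gaussian
  variables gives \<open>E exp (\<bar>P\<^sub>S \<sigma>\<bar>\<^sup>2 / 4) \<le> 2 powr (k / 2)\<close>. Summing over the \<open>d choose k\<close> supports
  and applying Jensen's inequality to the logarithm, the expected maximum of \<open>\<bar>P\<^sub>S \<sigma>\<bar>\<^sup>2\<close> is at most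
  \<open>4 ln ((d choose k) 2 powr (k / 2))\<close>, which is of order \<open>k ln (e d / k)\<close>.
\<close>

section \<open>Exponential moments of random signs and of a standard normal variable\<close>

text \<open>This is the scalar inequality behind Hoeffding's lemma at \<open>p = 1/2\<close> and
  \<open>h = 2 * \<bar>t\<bar>\<close>; the absolute value makes \<open>h\<close> nonnegative, and
  \<open>cosh\<close> is even.\<close>

lemma cosh_le_exp_half_square:
  fixes t :: real
  shows "cosh t \<le> exp (t\<^sup>2 / 2)"
proof -
  define u where "u = \<bar>t\<bar>"
  have pos: "0 < 1 + exp (2 * u)"
    by (simp add: add_pos_pos)
  have "- (2 * u) * (1 / 2) + ln (1 + 1 / 2 * (exp (2 * u) - 1)) \<le> (2 * u)\<^sup>2 / 8"
    by (rule Hoeffdings_lemma_aux) (simp_all add: u_def)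
  then have "ln ((1 + exp (2 * u)) / 2) \<le> u + u\<^sup>2 / 2"
    by (simp add: field_simps power2_eq_square)
  then have "(1 + exp (2 * u)) / 2 \<le> exp (u + u\<^sup>2 / 2)"
    using pos by (metis exp_le_cancel_iff exp_ln half_gt_zero)
  then have "exp (- u) * ((1 + exp (2 * u)) / 2) \<le> exp (- u) * exp (u + u\<^sup>2 / 2)"
    by (intro mult_left_mono) auto
  moreover have "exp (- u) * ((1 + exp (2 * u)) / 2) = cosh u"
    by (simp add: cosh_def algebra_simps mult_exp_exp)
  moreover have "exp (- u) * exp (u + u\<^sup>2 / 2) = exp (t\<^sup>2 / 2)"
    by (simp add: mult_exp_exp u_def)
  ultimately have "cosh u \<le> exp (t\<^sup>2 / 2)"
    by metis
  then show ?thesis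
    by (simp add: u_def)
qed

lemma finite_set_rademacher_signs: "finite (set_pmf (rademacher_signs n))"
  unfolding rademacher_signs_def by (subst set_Pi_pmf) auto

text \<open>Independence factorises the mean into a product of \<open>cosh (u i)\<close>. The
  right-hand side is the value for standard normal variables in place of the signs.\<close>

lemma nn_integral_rademacher_signs_exp_le:
  "(\<integral>\<^sup>+\<sigma>. ennreal (exp (\<Sum>i=1..n. \<sigma> i * u i)) \<partial>measure_pmf (rademacher_signs n))
     \<le> ennreal (exp ((\<Sum>i=1..n. (u i)\<^sup>2) / 2))"
proof -
  have one: "(\<integral>\<^sup>+s. ennreal (exp (s * t)) \<partial>measure_pmf (pmf_of_set {-1, 1})) = ennreal (cosh t)"
    for t :: real
    by (subst nn_integral_pmf_of_set)
       (auto simp: cosh_def ennreal_plus[symmetric] divide_ennreal add_pos_pos add.commute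
             simp del: ennreal_plus simp flip: ennreal_numeral)
  have "(\<integral>\<^sup>+\<sigma>. ennreal (exp (\<Sum>i=1..n. \<sigma> i * u i)) \<partial>measure_pmf (rademacher_signs n))
      = (\<integral>\<^sup>+\<sigma>. (\<Prod>i=1..n. ennreal (exp (\<sigma> i * u i))) \<partial>measure_pmf (rademacher_signs n))"
    by (simp add: exp_sum prod_ennreal)
  also have "\<dots> = (\<Prod>i=1..n. ennreal (cosh (u i)))"
    unfolding rademacher_signs_def by (subst nn_integral_prod_Pi_pmf) (simp_all add: one)
  also have "\<dots> = ennreal (\<Prod>i=1..n. cosh (u i))"
    by (simp add: prod_ennreal)
  also have "\<dots> \<le> ennreal (\<Prod>i=1..n. exp ((u i)\<^sup>2 / 2))"
    by (intro ennreal_leI prod_mono) (simp add: cosh_le_exp_half_square)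
  also have "\<dots> = ennreal (exp ((\<Sum>i=1..n. (u i)\<^sup>2) / 2))"
    by (simp add: exp_sum sum_divide_distrib)
  finally show ?thesis .
qed

lemma nn_integral_std_normal_exp:
  "(\<integral>\<^sup>+x. ennreal (exp (t * x)) \<partial>density lborel std_normal_density) = ennreal (exp (t\<^sup>2 / 2))"
proof -
  \<comment> \<open>Completing the square: the exponential tilt shifts the mean to \<open>t\<close>,
    and the shifted density integrates to 1.\<close>
  have "std_normal_density x * exp (t * x) = exp (t\<^sup>2 / 2) * normal_density t 1 x" for x
    by (simp add: normal_density_def exp_add[symmetric] field_simps power2_eq_square)
  then have "(\<integral>\<^sup>+x. ennreal (exp (t * x)) \<partial>density lborel std_normal_density)
      = (\<integral>\<^sup>+x. ennreal (exp (t\<^sup>2 / 2)) * ennreal (normal_density t 1 x) \<partial>lborel)"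
    by (simp add: nn_integral_density flip: ennreal_mult)
  then show ?thesis
    by (simp add: nn_integral_cmult nn_integral_eq_integral)
qed

text \<open>The weight \<open>exp (x^2 / 4)\<close> turns variance 1 into variance 2, and
  \<open>sqrt 2\<close> is the ratio of the normalising constants. It becomes the cost per dimension
  of the subspace.\<close>

lemma nn_integral_std_normal_exp_square:
  "(\<integral>\<^sup>+x. ennreal (exp (x\<^sup>2 / 4)) \<partial>density lborel std_normal_density) = ennreal (sqrt 2)"
proof -
  have "std_normal_density x * exp (x\<^sup>2 / 4) = sqrt 2 * normal_density 0 (sqrt 2) x" for x
    by (simp add: normal_density_def exp_add[symmetric] field_simps real_sqrt_mult)
  then have "(\<integral>\<^sup>+x. ennreal (exp (x\<^sup>2 / 4)) \<partial>density lborel std_normal_density)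
      = (\<integral>\<^sup>+x. ennreal (sqrt 2) * ennreal (normal_density 0 (sqrt 2) x) \<partial>lborel)"
    by (simp add: nn_integral_density flip: ennreal_mult)
  then show ?thesis
    by (simp add: nn_integral_cmult nn_integral_eq_integral)
qed

section \<open>Orthonormalisation of finite families\<close>

text \<open>
  Norm \<open>0\<close> is allowed so that linearly dependent families can be orthonormalised without changing
  their index set.
\<close>

definition quasi_orthonormal :: "'a set \<Rightarrow> 'b set \<Rightarrow> ('b \<Rightarrow> 'a \<Rightarrow> real) \<Rightarrow> bool" where
  "quasi_orthonormal I S e \<longleftrightarrow>
     (\<forall>j\<in>S. \<forall>l\<in>S. j \<noteq> l \<longrightarrow> (\<Sum>i\<in>I. e j i * e l i) = 0) \<and>
     (\<forall>j\<in>S. (\<Sum>i\<in>I. (e j i)\<^sup>2) = 0 \<or> (\<Sum>i\<in>I. (e j i)\<^sup>2) = 1)"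

lemma quasi_orthonormalD:
  assumes "quasi_orthonormal I S e" and "j \<in> S"
  shows "l \<in> S \<Longrightarrow> j \<noteq> l \<Longrightarrow> (\<Sum>i\<in>I. e j i * e l i) = 0"
    and "(\<Sum>i\<in>I. (e j i)\<^sup>2) = 0 \<or> (\<Sum>i\<in>I. (e j i)\<^sup>2) = 1"
  using assms unfolding quasi_orthonormal_def by blast+

text \<open>Gram-Schmidt by induction on the index set: each new vector loses its projection onto
  the earlier ones, and the residual is normalised.\<close>

lemma gram_schmidt_quasi_orthonormal:
  fixes f :: "'b \<Rightarrow> 'a \<Rightarrow> real"
  assumes "finite S" and I: "finite I"
  shows "\<exists>e. quasi_orthonormal I S e \<and> (\<exists>c. \<forall>j\<in>S. \<forall>i\<in>I. f j i = (\<Sum>l\<in>S. c j l * e l i))"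
  using assms(1)
proof (induction S rule: finite_induct)
  case empty
  then show ?case by (simp add: quasi_orthonormal_def)
next
  case (insert x S)
  from insert.IH obtain e c where e: "quasi_orthonormal I S e"
    and span: "\<forall>j\<in>S. \<forall>i\<in>I. f j i = (\<Sum>l\<in>S. c j l * e l i)"
    by (elim exE conjE)
  note orth = quasi_orthonormalD(1)[OF e] and nrm = quasi_orthonormalD(2)[OF e]
  define b where "b l = (\<Sum>i\<in>I. f x i * e l i)" for l
  define r where "r i = f x i - (\<Sum>l\<in>S. b l * e l i)" for i
  define q where "q = sqrt (\<Sum>i\<in>I. (r i)\<^sup>2)"
  \<comment> \<open>If \<open>q = 0\<close>, division by zero gives 0, so \<open>e' x\<close> is the
    zero function, which norm 0 permits.\<close>
  define e' where "e' = e(x := \<lambda>i. r i / q)"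
  have e'_S: "e' l = e l" if "l \<in> S" for l
    using that insert.hyps by (auto simp: e'_def)
  have q2: "q\<^sup>2 = (\<Sum>i\<in>I. (r i)\<^sup>2)"
    by (simp add: q_def sum_nonneg)
  have rq: "r i = q * e' x i" if "i \<in> I" for i
  proof (cases "q = 0")
    case True
    then have "(\<Sum>i\<in>I. (r i)\<^sup>2) = 0"
      using q2 by simp
    then have "r i = 0"
      using that I by (simp add: sum_nonneg_eq_0_iff)
    then show ?thesis using True by simp
  qed (simp add: e'_def)
  have zero: "e l i = 0" if "l \<in> S" "(\<Sum>i\<in>I. (e l i)\<^sup>2) = 0" "i \<in> I" for l i
    using that I by (simp add: sum_nonneg_eq_0_iff)
  have r_orth: "(\<Sum>i\<in>I. r i * e j i) = 0" if j: "j \<in> S" for j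
  proof -
    have "(\<Sum>i\<in>I. r i * e j i) = b j - (\<Sum>i\<in>I. \<Sum>l\<in>S. b l * (e l i * e j i))"
      by (simp add: r_def b_def algebra_simps sum_subtractf sum_distrib_left)
    also have "(\<Sum>i\<in>I. \<Sum>l\<in>S. b l * (e l i * e j i)) = (\<Sum>l\<in>S. b l * (\<Sum>i\<in>I. e l i * e j i))"
      by (subst sum.swap) (simp add: sum_distrib_left)
    also have "\<dots> = (\<Sum>l\<in>S. if l = j then b j * (\<Sum>i\<in>I. (e j i)\<^sup>2) else 0)"
      using orth j by (intro sum.cong) (auto simp: power2_eq_square)
    also have "\<dots> = b j * (\<Sum>i\<in>I. (e j i)\<^sup>2)"
      using j insert.hyps by simp
    \<comment> \<open>For norm 1 this is immediate; for norm 0, \<open>e j\<close> vanishes on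
      \<open>I\<close>, and so does the coefficient \<open>b j\<close>.\<close>
    also have "\<dots> = b j"
      using nrm[OF j] zero[OF j] by (auto simp: b_def)
    finally show ?thesis by simp
  qed
  have x_orth: "(\<Sum>i\<in>I. e' x i * e j i) = 0" if "j \<in> S" for j
    using r_orth[OF that] by (simp add: e'_def sum_divide_distrib[symmetric])
  have nrm_x: "(\<Sum>i\<in>I. (e' x i)\<^sup>2) = 0 \<or> (\<Sum>i\<in>I. (e' x i)\<^sup>2) = 1"
  proof -
    have "(\<Sum>i\<in>I. (e' x i)\<^sup>2) = (\<Sum>i\<in>I. (r i)\<^sup>2) / q\<^sup>2"
      by (simp add: e'_def power_divide sum_divide_distrib)
    then show ?thesis by (simp add: q2)
  qed
  have "quasi_orthonormal I (insert x S) e'"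
    unfolding quasi_orthonormal_def
  proof (intro conjI ballI impI)
    fix j l assume "j \<in> insert x S" "l \<in> insert x S" "j \<noteq> l"
    then consider "j = x" "l \<in> S" | "l = x" "j \<in> S" | "j \<in> S" "l \<in> S" by blast
    then show "(\<Sum>i\<in>I. e' j i * e' l i) = 0"
    proof cases
      case 1
      then show ?thesis using x_orth by (simp add: e'_S)
    next
      case 2
      then show ?thesis using x_orth by (simp add: e'_S mult.commute)
    next
      case 3
      then show ?thesis using orth \<open>j \<noteq> l\<close> by (simp add: e'_S)
    qed
  next
    fix j assume "j \<in> insert x S"
    then show "(\<Sum>i\<in>I. (e' j i)\<^sup>2) = 0 \<or> (\<Sum>i\<in>I. (e' j i)\<^sup>2) = 1"
      using nrm nrm_x e'_S by (metis insert_iff)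
  qed
  \<comment> \<open>The new vector is its projection plus \<open>q\<close> times
    \<open>e' x\<close>. For old vectors the coefficient at \<open>x\<close>, which the induction
    hypothesis leaves arbitrary, is reset to 0.\<close>
  moreover have "\<forall>j\<in>insert x S. \<forall>i\<in>I. f j i = (\<Sum>l\<in>insert x S. (if j = x then b(x := q) else (c j)(x := 0)) l * e' l i)"
  proof (intro ballI)
    fix j i assume j: "j \<in> insert x S" and i: "i \<in> I"
    have upd: "(\<Sum>l\<in>insert x S. (g(x := y)) l * e' l i) = y * e' x i + (\<Sum>l\<in>S. g l * e l i)" for g y
    proof -
      have "(\<Sum>l\<in>S. (g(x := y)) l * e' l i) = (\<Sum>l\<in>S. g l * e l i)"
        using insert.hyps by (intro sum.cong) (auto simp: e'_S)
      then show ?thesis using insert.hyps by simp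
    qed
    show "f j i = (\<Sum>l\<in>insert x S. (if j = x then b(x := q) else (c j)(x := 0)) l * e' l i)"
    proof (cases "j = x")
      case True
      then show ?thesis
        using rq[OF i, unfolded r_def] upd[of b q] by (simp only: if_True refl)
    next
      case False
      then show ?thesis
        using span i j upd[of "c j" 0] by (simp only: if_False) simp
    qed
  qed
  ultimately show ?case
    by (intro exI[of _ e'] conjI exI[of _ "\<lambda>j. if j = x then b(x := q) else (c j)(x := 0)"])
qed

text \<open>Pythagoras: the mixed products vanish. The squared norms stay as factors because they
  may be 0.\<close>

lemma sum_square_orthogonal_combination:
  fixes e :: "'b \<Rightarrow> 'a \<Rightarrow> real"
  assumes "finite S" and e: "quasi_orthonormal I S e"
  shows "(\<Sum>i\<in>I. (\<Sum>l\<in>S. g l * e l i)\<^sup>2) = (\<Sum>l\<in>S. (g l)\<^sup>2 * (\<Sum>i\<in>I. (e l i)\<^sup>2))"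
proof -
  have "(\<Sum>i\<in>I. (\<Sum>l\<in>S. g l * e l i)\<^sup>2) = (\<Sum>i\<in>I. \<Sum>j\<in>S. \<Sum>l\<in>S. g j * g l * (e j i * e l i))"
    by (simp add: power2_eq_square sum_product mult_ac)
  also have "\<dots> = (\<Sum>j\<in>S. \<Sum>i\<in>I. \<Sum>l\<in>S. g j * g l * (e j i * e l i))"
    by (rule sum.swap)
  also have "\<dots> = (\<Sum>j\<in>S. \<Sum>l\<in>S. g j * g l * (\<Sum>i\<in>I. e j i * e l i))"
    by (intro sum.cong refl, subst sum.swap) (simp add: sum_distrib_left)
  also have "\<dots> = (\<Sum>j\<in>S. \<Sum>l\<in>S. if l = j then (g j)\<^sup>2 * (\<Sum>i\<in>I. (e j i)\<^sup>2) else 0)"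
    using quasi_orthonormalD(1)[OF e] by (intro sum.cong refl) (auto simp: power2_eq_square)
  also have "\<dots> = (\<Sum>l\<in>S. (g l)\<^sup>2 * (\<Sum>i\<in>I. (e l i)\<^sup>2))"
    using assms(1) by simp
  finally show ?thesis .
qed

section \<open>Exponential moment of the squared projection of the signs\<close>

text \<open>
  Gaussian linearisation: \<open>exp (a\<^sup>2 / 4)\<close> is the mean of \<open>exp (a g / \<surd>2)\<close> for a standard normal \<open>g\<close>.
  With the exponent linear in the signs, their average factorises.
\<close>

lemma nn_integral_rademacher_exp_projection_le:
  assumes S: "finite S" and e: "quasi_orthonormal {1..n} S e"
  shows "(\<integral>\<^sup>+\<sigma>. ennreal (exp ((\<Sum>l\<in>S. (\<Sum>i=1..n. \<sigma> i * e l i)\<^sup>2) / 4)) \<partial>measure_pmf (rademacher_signs n))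
     \<le> ennreal (sqrt 2 ^ card S)"
proof -
  define N where "N = density lborel std_normal_density"
  define a where "a \<sigma> l = (\<Sum>i=1..n. \<sigma> i * e l i)" for \<sigma> l
  define R where "R = rademacher_signs n"
  have sets_N [measurable_cong]: "sets N = sets borel"
    by (simp add: N_def)
  interpret N: prob_space N
    unfolding N_def by (rule prob_space_normal_density) simp
  interpret product_sigma_finite "\<lambda>_. N" ..
  let ?P = "Pi\<^sub>M S (\<lambda>_. N)"
  have lin: "ennreal (exp ((\<Sum>l\<in>S. (a \<sigma> l)\<^sup>2) / 4))
      = (\<integral>\<^sup>+g. ennreal (exp (\<Sum>l\<in>S. a \<sigma> l / sqrt 2 * g l)) \<partial>?P)" for \<sigma>
  proof -
    have "(\<integral>\<^sup>+g. ennreal (exp (\<Sum>l\<in>S. a \<sigma> l / sqrt 2 * g l)) \<partial>?P)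
        = (\<integral>\<^sup>+g. (\<Prod>l\<in>S. ennreal (exp (a \<sigma> l / sqrt 2 * g l))) \<partial>?P)"
      using S by (simp add: exp_sum prod_ennreal)
    also have "\<dots> = (\<Prod>l\<in>S. \<integral>\<^sup>+x. ennreal (exp (a \<sigma> l / sqrt 2 * x)) \<partial>N)"
      by (rule product_nn_integral_prod[OF S]) measurable
    also have "\<dots> = (\<Prod>l\<in>S. ennreal (exp ((a \<sigma> l)\<^sup>2 / 4)))"
      unfolding N_def nn_integral_std_normal_exp by (simp add: power_divide)
    also have "\<dots> = ennreal (exp ((\<Sum>l\<in>S. (a \<sigma> l)\<^sup>2) / 4))"
      using S by (simp add: prod_ennreal exp_sum sum_divide_distrib)
    finally show ?thesis by simp
  qed
  \<comment> \<open>For fixed \<open>g\<close> the exponent becomes a linear form in the signs, as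
    the sign bound requires.\<close>
  have swap: "(\<Sum>l\<in>S. a \<sigma> l / sqrt 2 * g l) = (\<Sum>i=1..n. \<sigma> i * ((\<Sum>l\<in>S. g l * e l i) / sqrt 2))" for \<sigma> g
    unfolding a_def sum_distrib_left sum_distrib_right sum_divide_distrib
    by (subst sum.swap) (simp add: mult_ac)
  \<comment> \<open>The sign distribution has finite support, so exchanging the two averages only
    moves a finite sum through the Gaussian integral.\<close>
  have "(\<integral>\<^sup>+\<sigma>. ennreal (exp ((\<Sum>l\<in>S. (a \<sigma> l)\<^sup>2) / 4)) \<partial>measure_pmf R)
      = (\<Sum>\<sigma>\<in>set_pmf R. (\<integral>\<^sup>+g. ennreal (exp (\<Sum>l\<in>S. a \<sigma> l / sqrt 2 * g l)) \<partial>?P) * pmf R \<sigma>)"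
    unfolding lin by (rule nn_integral_measure_pmf_finite) (simp_all add: R_def finite_set_rademacher_signs)
  also have "\<dots> = (\<integral>\<^sup>+g. (\<Sum>\<sigma>\<in>set_pmf R. ennreal (exp (\<Sum>l\<in>S. a \<sigma> l / sqrt 2 * g l)) * pmf R \<sigma>) \<partial>?P)"
    by (subst nn_integral_sum) (simp_all add: nn_integral_multc)
  also have "\<dots> = (\<integral>\<^sup>+g. (\<integral>\<^sup>+\<sigma>. ennreal (exp (\<Sum>l\<in>S. a \<sigma> l / sqrt 2 * g l)) \<partial>measure_pmf R) \<partial>?P)"
    by (subst nn_integral_measure_pmf_finite) (simp_all add: R_def finite_set_rademacher_signs)
  also have "\<dots> \<le> (\<integral>\<^sup>+g. ennreal (exp ((\<Sum>i=1..n. ((\<Sum>l\<in>S. g l * e l i) / sqrt 2)\<^sup>2) / 2)) \<partial>?P)"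
    unfolding swap R_def by (intro nn_integral_mono nn_integral_rademacher_signs_exp_le)
  also have "\<dots> \<le> (\<integral>\<^sup>+g. (\<Prod>l\<in>S. ennreal (exp ((g l)\<^sup>2 / 4))) \<partial>?P)"
  proof (intro nn_integral_mono)
    fix g
    have "(\<Sum>i=1..n. ((\<Sum>l\<in>S. g l * e l i) / sqrt 2)\<^sup>2) / 2 = (\<Sum>i=1..n. (\<Sum>l\<in>S. g l * e l i)\<^sup>2) / 4"
      by (simp add: power_divide sum_divide_distrib[symmetric])
    also have "\<dots> = (\<Sum>l\<in>S. (g l)\<^sup>2 * (\<Sum>i=1..n. (e l i)\<^sup>2)) / 4"
      by (subst sum_square_orthogonal_combination[OF S e]) simp
    \<comment> \<open>Members of norm 0 only decrease the sum, and what remains factorises over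
      \<open>S\<close>.\<close>
    also have "\<dots> \<le> (\<Sum>l\<in>S. (g l)\<^sup>2) / 4"
      using quasi_orthonormalD(2)[OF e] by (intro divide_right_mono sum_mono mult_left_le) fastforce+
    finally show "ennreal (exp ((\<Sum>i=1..n. ((\<Sum>l\<in>S. g l * e l i) / sqrt 2)\<^sup>2) / 2))
        \<le> (\<Prod>l\<in>S. ennreal (exp ((g l)\<^sup>2 / 4)))"
      using S by (simp add: prod_ennreal sum_divide_distrib flip: exp_sum)
  qed
  also have "\<dots> = (\<Prod>l\<in>S. \<integral>\<^sup>+x. ennreal (exp (x\<^sup>2 / 4)) \<partial>N)"
    by (rule product_nn_integral_prod[OF S]) measurable
  also have "\<dots> = ennreal (sqrt 2 ^ card S)"
    unfolding N_def nn_integral_std_normal_exp_square by (simp add: ennreal_power)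
  finally show ?thesis
    by (simp add: a_def R_def)
qed

section \<open>Deterministic bounds for a fixed support and the number of supports\<close>

text \<open>In orthonormal coordinates the objective splits into separate quadratics
  \<open>b * a - \<gamma> * b^2\<close>, each with maximum
  \<open>a^2 / (4 * \<gamma>)\<close>.\<close>

lemma offset_objective_le_projection:
  fixes I :: "'a set" and S :: "'b set" and e :: "'b \<Rightarrow> 'a \<Rightarrow> real"
  assumes S: "finite S" and I: "finite I" and "\<gamma> > 0" and e: "quasi_orthonormal I S e"
    and v: "\<And>i. i \<in> I \<Longrightarrow> v i = (\<Sum>l\<in>S. b l * e l i)"
  shows "(\<Sum>i\<in>I. \<sigma> i * v i - \<gamma> * (v i)\<^sup>2) \<le> (\<Sum>l\<in>S. (\<Sum>i\<in>I. \<sigma> i * e l i)\<^sup>2) / (4 * \<gamma>)"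
proof -
  define a where "a l = (\<Sum>i\<in>I. \<sigma> i * e l i)" for l
  have "(\<Sum>i\<in>I. \<sigma> i * v i) = (\<Sum>l\<in>S. b l * a l)"
  proof -
    have "(\<Sum>i\<in>I. \<sigma> i * v i) = (\<Sum>i\<in>I. \<Sum>l\<in>S. b l * (\<sigma> i * e l i))"
      by (simp add: v sum_distrib_left mult_ac)
    also have "\<dots> = (\<Sum>l\<in>S. b l * a l)"
      by (subst sum.swap) (simp add: a_def sum_distrib_left)
    finally show ?thesis .
  qed
  moreover have "(\<Sum>i\<in>I. (v i)\<^sup>2) = (\<Sum>l\<in>S. (b l)\<^sup>2 * (\<Sum>i\<in>I. (e l i)\<^sup>2))"
    using sum_square_orthogonal_combination[OF S e, of b] by (simp add: v)
  ultimately have "(\<Sum>i\<in>I. \<sigma> i * v i - \<gamma> * (v i)\<^sup>2)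
      = (\<Sum>l\<in>S. b l * a l - \<gamma> * ((b l)\<^sup>2 * (\<Sum>i\<in>I. (e l i)\<^sup>2)))"
    by (simp add: sum_subtractf sum_distrib_left[symmetric])
  also have "\<dots> \<le> (\<Sum>l\<in>S. (a l)\<^sup>2 / (4 * \<gamma>))"
  proof (intro sum_mono)
    fix l assume l: "l \<in> S"
    show "b l * a l - \<gamma> * ((b l)\<^sup>2 * (\<Sum>i\<in>I. (e l i)\<^sup>2)) \<le> (a l)\<^sup>2 / (4 * \<gamma>)"
    proof (cases "(\<Sum>i\<in>I. (e l i)\<^sup>2) = 0")
      \<comment> \<open>Norm 0 forces \<open>e l\<close> to vanish on \<open>I\<close>, so the
        linear term is 0 as well.\<close>
      case True
      then have "a l = 0"
        using I by (simp add: a_def sum_nonneg_eq_0_iff)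
      then show ?thesis using True by simp
    next
      case False
      then have 1: "(\<Sum>i\<in>I. (e l i)\<^sup>2) = 1"
        using quasi_orthonormalD(2)[OF e l] by simp
      have "0 \<le> (a l - 2 * \<gamma> * b l)\<^sup>2 / (4 * \<gamma>)"
        using \<open>\<gamma> > 0\<close> by simp
      also have "\<dots> = (a l)\<^sup>2 / (4 * \<gamma>) - (b l * a l - \<gamma> * (b l)\<^sup>2)"
        using \<open>\<gamma> > 0\<close> by (simp add: field_simps power2_eq_square)
      finally show ?thesis by (simp add: 1)
    qed
  qed
  finally show ?thesis
    by (simp add: a_def sum_divide_distrib)
qed

text \<open>The quotient \<open>k^k / fact k\<close> is one term of the series of
  \<open>exp k\<close>, while \<open>(d choose k) * fact k\<close> is at most
  \<open>d^k\<close>.\<close>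

lemma binomial_le_exp_power:
  assumes "1 \<le> k"
  shows "real (d choose k) \<le> (exp 1 * real d / real k) ^ k"
proof -
  have "real k ^ k / fact k \<le> exp (real k)"
    using sum_le_suminf[OF summable_exp[of "real k"], of "{k}"]
    by (simp add: exp_def divide_inverse mult.commute)
  then have "real k ^ k \<le> exp (real k) * fact k"
    by (simp add: field_simps)
  then have "real (d choose k) * real k ^ k \<le> real (d choose k) * (exp (real k) * fact k)"
    by (intro mult_left_mono) auto
  also have "\<dots> = exp (real k) * real ((d choose k) * fact k)"
    by simp
  also have "\<dots> \<le> exp (real k) * real (d ^ k)"
    by (intro mult_left_mono of_nat_mono binomial_fact_pow) auto
  also have "\<dots> = (exp 1 * real d) ^ k"
    by (simp add: power_mult_distrib exp_of_nat_mult[symmetric])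
  finally show ?thesis
    using assms by (simp add: power_divide field_simps)
qed

text \<open>The support of the weights is padded to exactly \<open>k\<close> coordinates, possible
  as \<open>k \<le> d\<close>; the added weights are 0. Hence only \<open>d choose k\<close>
  supports have to be considered.\<close>

lemma sparse_prediction_eq_sum:
  assumes "h \<in> sparse_linear_predictors d k" and "k \<le> d"
  obtains S w where "S \<subseteq> {..<d}" "card S = k"
    and "\<forall>x\<in>carrier_vec d. h x = (\<Sum>j\<in>S. w j * vec_index x j)"
proof -
  obtain w where w: "w \<in> carrier_vec d" "l0_norm w \<le> k" and h: "h = (\<lambda>x. scalar_prod w x)"
    using assms(1) by (auto simp: sparse_linear_predictors_def)
  define T where "T = {j. j < d \<and> vec_index w j \<noteq> 0}"
  have T: "T \<subseteq> {..<d}" "card T \<le> k"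
    using w by (auto simp: T_def l0_norm_def)
  then obtain S where S: "T \<subseteq> S" "S \<subseteq> {..<d}" "card S = k"
    using exists_subset_between[of T k "{..<d}"] assms(2) by auto
  have "h x = (\<Sum>j\<in>S. vec_index w j * vec_index x j)" if "x \<in> carrier_vec d" for x
  proof -
    have "h x = (\<Sum>j\<in>{0..<d}. vec_index w j * vec_index x j)"
      using that by (simp add: h scalar_prod_def)
    also have "\<dots> = (\<Sum>j\<in>S. vec_index w j * vec_index x j)"
      using S by (intro sum.mono_neutral_right) (auto simp: T_def)
    finally show ?thesis .
  qed
  then show thesis
    using that S by blast
qed

section \<open>Maximum over all supports\<close>

lemma offset_rademacher_sparse_le:
  assumes k: "1 \<le> k" "k \<le> d" and n: "1 \<le> n"
    and \<Phi>: "\<And>i. i \<in> {1..n} \<Longrightarrow> \<Phi> i \<in> carrier_vec d" and \<gamma>: "\<gamma> > 0"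
  shows "offset_rademacher n \<Phi> (sparse_linear_predictors d k) \<gamma>
    \<le> ln (real (d choose k) * sqrt 2 ^ k) / (\<gamma> * real n)"
proof -
  define \<S> where "\<S> = {S. S \<subseteq> {..<d} \<and> card S = k}"
  have fin\<S>: "finite \<S>" and card\<S>: "card \<S> = d choose k"
    using n_subsets[of "{..<d}" k] by (auto simp: \<S>_def)
  have finS: "finite S" if "S \<in> \<S>" for S
    using that finite_subset by (auto simp: \<S>_def)
  \<comment> \<open>The orthonormal systems depend on the sample only, so they are fixed before the
    signs are averaged.\<close>
  have "\<forall>S\<in>\<S>. \<exists>e. quasi_orthonormal {1..n} S e \<and>
      (\<exists>c. \<forall>j\<in>S. \<forall>i\<in>{1..n}. vec_index (\<Phi> i) j = (\<Sum>l\<in>S. c j l * e l i))"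
    by (intro ballI gram_schmidt_quasi_orthonormal finS finite_atLeastAtMost)
  from bchoice[OF this] obtain e where "\<forall>S\<in>\<S>. quasi_orthonormal {1..n} S (e S) \<and>
      (\<exists>c. \<forall>j\<in>S. \<forall>i\<in>{1..n}. vec_index (\<Phi> i) j = (\<Sum>l\<in>S. c j l * e S l i))" ..
  then have e: "\<And>S. S \<in> \<S> \<Longrightarrow> quasi_orthonormal {1..n} S (e S)"
    and span: "\<And>S. S \<in> \<S> \<Longrightarrow> \<exists>c. \<forall>j\<in>S. \<forall>i\<in>{1..n}. vec_index (\<Phi> i) j = (\<Sum>l\<in>S. c j l * e S l i)"
    by blast+
  \<comment> \<open>\<open>M S \<sigma>\<close> is the squared norm of the projection of
    \<open>\<sigma>\<close> onto the span of \<open>e S\<close>; \<open>\<mu>\<close> will bound the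
    mean of \<open>Z\<close>.\<close>
  define M where "M S \<sigma> = (\<Sum>l\<in>S. (\<Sum>i=1..n. \<sigma> i * e S l i)\<^sup>2)" for S and \<sigma> :: "nat \<Rightarrow> real"
  define Z where "Z \<sigma> = (\<Sum>S\<in>\<S>. exp (M S \<sigma> / 4))" for \<sigma>
  define \<mu> where "\<mu> = real (d choose k) * sqrt 2 ^ k"
  define F where "F \<sigma> = (SUP h\<in>sparse_linear_predictors d k.
      1 / real n * (\<Sum>i=1..n. (\<sigma> i * h (\<Phi> i) - \<gamma> * (h (\<Phi> i))\<^sup>2)))" for \<sigma>
  define R where "R = rademacher_signs n"
  have \<mu>_pos: "\<mu> > 0"
    using k by (simp add: \<mu>_def)
  \<comment> \<open>Finite support makes every real function of the signs integrable, including the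
    supremum \<open>F\<close>.\<close>
  have int: "integrable (measure_pmf R) f" for f :: "_ \<Rightarrow> real"
    unfolding R_def by (intro integrable_measure_pmf_finite finite_set_rademacher_signs)
  have "measure_pmf.expectation R (\<lambda>\<sigma>. exp (M S \<sigma> / 4)) \<le> sqrt 2 ^ k" if S: "S \<in> \<S>" for S
  proof -
    have "ennreal (measure_pmf.expectation R (\<lambda>\<sigma>. exp (M S \<sigma> / 4)))
        = (\<integral>\<^sup>+\<sigma>. ennreal (exp (M S \<sigma> / 4)) \<partial>measure_pmf R)"
      by (intro nn_integral_eq_integral[symmetric] int) auto
    also have "\<dots> \<le> ennreal (sqrt 2 ^ card S)"
      unfolding M_def R_def
      by (rule nn_integral_rademacher_exp_projection_le[OF finS[OF S] e[OF S]])
    finally show ?thesis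
      using S by (simp add: \<S>_def)
  qed
  then have "(\<Sum>S\<in>\<S>. measure_pmf.expectation R (\<lambda>\<sigma>. exp (M S \<sigma> / 4))) \<le> (\<Sum>S\<in>\<S>. sqrt 2 ^ k)"
    by (rule sum_mono)
  then have EZ: "measure_pmf.expectation R Z \<le> \<mu>"
    unfolding Z_def by (subst Bochner_Integration.integral_sum) (simp_all add: int card\<S> \<mu>_def)
  \<comment> \<open>Jensen for \<open>ln\<close>, via its tangent at \<open>\<mu>\<close>.\<close>
  have F_le: "F \<sigma> \<le> 1 / (\<gamma> * real n) * (ln \<mu> + Z \<sigma> / \<mu> - 1)" for \<sigma>
    unfolding F_def
  proof (rule cSUP_least)
    \<comment> \<open>Bounding a real supremum from above requires a nonempty class; the zero
      predictor belongs to it.\<close>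
    have "l0_norm (0\<^sub>v d) = 0"
      by (simp add: l0_norm_def cong: conj_cong)
    then have "(\<lambda>x. scalar_prod (0\<^sub>v d) x) \<in> sparse_linear_predictors d k"
      by (auto simp: sparse_linear_predictors_def intro!: exI[of _ "0\<^sub>v d"])
    then show "sparse_linear_predictors d k \<noteq> {}" by blast
  next
    fix h assume "h \<in> sparse_linear_predictors d k"
    then obtain S w where "S \<subseteq> {..<d}" "card S = k"
      and h: "\<forall>x\<in>carrier_vec d. h x = (\<Sum>j\<in>S. w j * vec_index x j)"
      using k(2) by (rule sparse_prediction_eq_sum)
    then have S: "S \<in> \<S>" by (simp add: \<S>_def)
    obtain c where c: "\<And>j i. j \<in> S \<Longrightarrow> i \<in> {1..n} \<Longrightarrow> vec_index (\<Phi> i) j = (\<Sum>l\<in>S. c j l * e S l i)"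
      using span[OF S] by blast
    have v: "h (\<Phi> i) = (\<Sum>l\<in>S. (\<Sum>j\<in>S. w j * c j l) * e S l i)" if i: "i \<in> {1..n}" for i
    proof -
      have "h (\<Phi> i) = (\<Sum>j\<in>S. \<Sum>l\<in>S. w j * c j l * e S l i)"
        using i by (simp add: bspec[OF h \<Phi>[OF i]] c sum_distrib_left mult_ac)
      also have "\<dots> = (\<Sum>l\<in>S. (\<Sum>j\<in>S. w j * c j l) * e S l i)"
        by (subst sum.swap) (simp add: sum_distrib_right)
      finally show ?thesis .
    qed
    have "(\<Sum>i=1..n. \<sigma> i * h (\<Phi> i) - \<gamma> * (h (\<Phi> i))\<^sup>2) \<le> M S \<sigma> / (4 * \<gamma>)"
      unfolding M_def
      by (rule offset_objective_le_projection[OF finS[OF S] _ \<gamma> e[OF S] v]) auto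
    also have "\<dots> \<le> (ln \<mu> + Z \<sigma> / \<mu> - 1) / \<gamma>"
    proof -
      \<comment> \<open>A single positive term is at most the whole sum, which gives a bound uniform
        in \<open>S\<close>.\<close>
      have "exp (M S \<sigma> / 4) \<le> Z \<sigma>"
        unfolding Z_def using S fin\<S> by (intro member_le_sum) auto
      moreover from this have Zpos: "Z \<sigma> > 0"
        using exp_gt_zero less_le_trans by blast
      ultimately have "M S \<sigma> / 4 \<le> ln (Z \<sigma>)"
        by (subst ln_ge_iff)
      also have "\<dots> = ln \<mu> + ln (Z \<sigma> / \<mu>)"
        using Zpos \<mu>_pos by (simp add: ln_div)
      also have "\<dots> \<le> ln \<mu> + Z \<sigma> / \<mu> - 1"
        using ln_le_minus_one[of "Z \<sigma> / \<mu>"] Zpos \<mu>_pos by simp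
      finally show ?thesis
        using \<gamma> by (simp add: field_simps)
    qed
    finally have "1 / real n * (\<Sum>i=1..n. \<sigma> i * h (\<Phi> i) - \<gamma> * (h (\<Phi> i))\<^sup>2)
        \<le> 1 / real n * ((ln \<mu> + Z \<sigma> / \<mu> - 1) / \<gamma>)"
      by (rule mult_left_mono) simp
    then show "1 / real n * (\<Sum>i=1..n. \<sigma> i * h (\<Phi> i) - \<gamma> * (h (\<Phi> i))\<^sup>2)
        \<le> 1 / (\<gamma> * real n) * (ln \<mu> + Z \<sigma> / \<mu> - 1)"
      by (simp add: mult.commute)
  qed
  have "offset_rademacher n \<Phi> (sparse_linear_predictors d k) \<gamma> = measure_pmf.expectation R F"
    unfolding offset_rademacher_def F_def[abs_def] R_def ..
  also have "\<dots> \<le> measure_pmf.expectation R (\<lambda>\<sigma>. 1 / (\<gamma> * real n) * (ln \<mu> + Z \<sigma> / \<mu> - 1))"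
    by (intro integral_mono int F_le)
  also have "\<dots> = 1 / (\<gamma> * real n) * (ln \<mu> + measure_pmf.expectation R Z / \<mu> - 1)"
    by (simp add: int)
  \<comment> \<open>As the mean of \<open>Z\<close> is at most \<open>\<mu>\<close>, the tangent
    correction is nonpositive.\<close>
  also have "\<dots> \<le> 1 / (\<gamma> * real n) * ln \<mu>"
    using EZ \<mu>_pos \<gamma> by (intro mult_left_mono) (auto simp: field_simps)
  finally show ?thesis
    by (simp add: \<mu>_def)
qed

section \<open>The universal constant\<close>

theorem lemma4p1:
  "\<exists>c::real. c > 0 \<and>
     (\<forall>(d::nat) (k::nat) (n::nat) (\<Phi> :: nat \<Rightarrow> real Matrix.vec) (\<gamma>::real).
        1 \<le> k \<and> k \<le> d \<and> 1 \<le> n \<and> (\<forall>i\<in>{1..n}. \<Phi> i \<in> carrier_vec d) \<and> \<gamma> > 0 \<longrightarrow>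
        offset_rademacher n \<Phi> (sparse_linear_predictors d k) \<gamma>
          \<le> c / \<gamma> * ln (exp 1 * real d / real k) * (real k / real n))"
\<comment> \<open>Of the constant 2, one unit pays for the binomial coefficient and one for the
  factor \<open>sqrt 2 ^ k\<close>.\<close>
proof (intro exI[of _ 2] conjI allI impI)
  fix d k n :: nat and \<Phi> :: "nat \<Rightarrow> real Matrix.vec" and \<gamma> :: real
  assume "1 \<le> k \<and> k \<le> d \<and> 1 \<le> n \<and> (\<forall>i\<in>{1..n}. \<Phi> i \<in> carrier_vec d) \<and> \<gamma> > 0"
  then have k: "1 \<le> k" "k \<le> d" and n: "1 \<le> n" and \<Phi>: "\<And>i. i \<in> {1..n} \<Longrightarrow> \<Phi> i \<in> carrier_vec d"
    and \<gamma>: "\<gamma> > 0" by auto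
  define r where "r = exp 1 * real d / real k"
  have r: "exp 1 \<le> r"
    using k by (simp add: r_def field_simps)
  then have r_pos: "r > 0"
    using exp_gt_zero less_le_trans by blast
  have ln_r: "ln r \<ge> 1"
    using r r_pos by (simp add: ln_ge_iff)
  have "ln (real (d choose k) * sqrt 2 ^ k) = ln (real (d choose k)) + real k * (ln 2 / 2)"
    using k by (simp add: ln_mult ln_realpow ln_sqrt)
  also have "ln (real (d choose k)) \<le> ln (r ^ k)"
    unfolding r_def using k binomial_le_exp_power[OF k(1), of d] by (intro ln_mono) auto
  also have "ln (r ^ k) = real k * ln r"
    using r_pos by (simp add: ln_realpow)
  \<comment> \<open>Since \<open>k \<le> d\<close>, the logarithm \<open>ln r\<close> is at least 1
    and absorbs \<open>ln 2 / 2\<close>.\<close>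
  also have "real k * (ln 2 / 2) \<le> real k * ln r"
    using ln_r ln_2_less_1 by (intro mult_left_mono) auto
  finally have "ln (real (d choose k) * sqrt 2 ^ k) \<le> 2 * real k * ln r"
    by simp
  then have "ln (real (d choose k) * sqrt 2 ^ k) / (\<gamma> * real n) \<le> 2 * real k * ln r / (\<gamma> * real n)"
    using \<gamma> by (intro divide_right_mono) auto
  then have "offset_rademacher n \<Phi> (sparse_linear_predictors d k) \<gamma> \<le> 2 * real k * ln r / (\<gamma> * real n)"
    using offset_rademacher_sparse_le[OF k n \<Phi> \<gamma>] by (meson order_trans)
  then show "offset_rademacher n \<Phi> (sparse_linear_predictors d k) \<gamma>
      \<le> 2 / \<gamma> * ln (exp 1 * real d / real k) * (real k / real n)"
    by (simp add: r_def mult_ac)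
qed simp

end
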